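(* Let $A \in \mathbb{R}^{n \times n}$ be a matrix of rank at most $2$ (entries may be negative). Then $$\operatorname{per}(A)^2 \geq \frac{1}{\binom{2n}{n}} \operatorname{per}(A \otimes J_2).$$
   Context: For $A \in \mathbb{R}^{n\times n}$, the permanent is $\operatorname{per}(A) = \sum_{\pi \in \mathcal{S}_n} \prod_{i=1}^n A_{i,\pi(i)}$, where $\mathcal{S}_n$ is the symmetric group on $[n]=\{1,\dots,n\}$. $J_2$ is the $2\times 2$ all-ones matrix and $\otimes$ is the Kronecker product, so $A\otimes J_2$ is a $2n\times 2n$ matrix. *)

theory Defs
  imports "HOL-Analysis.Analysis"
begin

definition permanent :: "'a::comm_semiring_1 ^ 'n ^ 'n \<Rightarrow> 'a" where
  "permanent A = (\<Sum>p | p permutes (UNIV :: 'n set). \<Prod>i\<in>UNIV. A $ i $ p i)"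

text \<open>The pair \<open>(i, k)\<close> indexes row \<open>k\<close> of block row \<open>i\<close>; columns likewise.\<close>

definition kronecker_product ::
    "'a::times ^ 'n ^ 'm \<Rightarrow> 'a ^ 'l ^ 'k \<Rightarrow> 'a ^ ('n \<times> 'l) ^ ('m \<times> 'k)" where
  "kronecker_product A B = (\<chi> r c. A $ fst r $ fst c * B $ snd r $ snd c)"

definition J2 :: "real ^ 2 ^ 2" where
  "J2 = (\<chi> i j. 1)"

end

theory Submission
  imports Defs "HOL-Computational_Algebra.Polynomial"
begin

text \<open>
  Write \<open>A\<^sub>i\<^sub>j = x\<^sub>i y\<^sub>j + z\<^sub>i w\<^sub>j\<close> and let \<open>p\<close>, \<open>q\<close> be the products of the binary linear forms
  \<open>x\<^sub>i s + z\<^sub>i t\<close> and \<open>y\<^sub>j s + w\<^sub>j t\<close>. Then \<open>per A = n! \<langle>p, q\<rangle>\<close> for the Bombieri inner product, and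
  \<open>per (A \<otimes> J\<^sub>2) = (2n)! \<langle>p\<^sup>2, q\<^sup>2\<rangle>\<close>, so the claim is \<open>\<langle>p\<^sup>2, q\<^sup>2\<rangle> \<le> \<langle>p, q\<rangle>\<^sup>2\<close>.

  On biforms of bidegree \<open>(n, n)\<close> let \<open>X\<close> be multiplication by the bracket of the two variables and
  \<open>\<Omega>\<close> Cayley's operator, its adjoint up to a factor. The eigenvalues of the Casimir operator
  \<open>T = X \<Omega>\<close> are \<open>j (2 n + 1 - j)\<close>, and \<open>\<langle>p\<^sup>2, q\<^sup>2\<rangle>\<close> is obtained from \<open>\<langle>p \<otimes> p, q \<otimes> q\<rangle> = \<langle>p, q\<rangle>\<^sup>2\<close> by
  projecting onto the kernel of \<open>T\<close>. More generally
  \<open>\<langle>\<phi>(T) (p \<otimes> p), q \<otimes> q\<rangle> \<ge> 0\<close> whenever \<open>\<phi>\<close> is nonnegative and nondecreasing on the eigenvalues with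
  even \<open>j\<close>. Indeed \<open>\<Omega> (p \<otimes> p) = - X R\<close>, where \<open>R\<close> is the sum of \<open>[l\<^sub>i, l\<^sub>j]\<^sup>2 r \<otimes> r\<close> over pairs of factors
  \<open>l\<^sub>i\<close>, \<open>l\<^sub>j\<close> of \<open>p\<close> and \<open>r = p / (l\<^sub>i l\<^sub>j)\<close>; with \<open>\<Omega> X = X \<Omega> + 2 n\<close> on bidegree \<open>(n - 1, n - 1)\<close> this turns
  \<open>\<phi> - \<phi>(0)\<close> in degree \<open>n\<close> into a positive combination of the same expressions in degree
  \<open>m = n - 2\<close>, for the function \<open>(t + 2 m + 2) / (t + 4 m + 6) (\<phi>(t + 4 m + 6) - \<phi>(0))\<close>, which is again
  nonnegative and nondecreasing.
\<close>

text \<open>A biform is given by its coefficients: \<open>g a b\<close> belongs to \<open>s\<^sub>1\<^sup>a t\<^sub>1\<^sup>n\<^sup>-\<^sup>a s\<^sub>2\<^sup>b t\<^sub>2\<^sup>n\<^sup>-\<^sup>b\<close>, with the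
  bidegree \<open>(n, n)\<close> left implicit.\<close>
type_synonym biform = "nat \<Rightarrow> nat \<Rightarrow> real"

section \<open>Polynomials in a linear operator\<close>

definition linear_op :: "(biform \<Rightarrow> biform) \<Rightarrow> bool" where
  "linear_op T \<longleftrightarrow> (\<forall>f g c d. T (\<lambda>a b. c * f a b + d * g a b) = (\<lambda>a b. c * T f a b + d * T g a b))"

lemma linear_opD:
  "linear_op T \<Longrightarrow> T (\<lambda>a b. c * f a b + d * g a b) = (\<lambda>a b. c * T f a b + d * T g a b)"
  by (auto simp: linear_op_def)

lemma linear_op_zero: "linear_op T \<Longrightarrow> T (\<lambda>a b. 0) = (\<lambda>a b. 0)"
  using linear_opD[of T 0 "\<lambda>a b. 0" 0 "\<lambda>a b. 0"] by simp

lemma linear_op_add: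
  "linear_op T \<Longrightarrow> T (\<lambda>a b. f a b + g a b) = (\<lambda>a b. T f a b + T g a b)"
  using linear_opD[of T 1 f 1 g] by simp

lemma linear_op_scale: "linear_op T \<Longrightarrow> T (\<lambda>a b. c * f a b) = (\<lambda>a b. c * T f a b)"
  using linear_opD[of T c f 0 f] by simp

lemma linear_op_sum:
  assumes "linear_op T"
  shows "T (\<lambda>a b. \<Sum>k\<in>K. c k * g k a b) = (\<lambda>a b. \<Sum>k\<in>K. c k * T (g k) a b)"
proof (induction K rule: infinite_finite_induct)
  case (insert k K)
  then show ?case
    using linear_opD[OF assms, of "c k" "g k" 1 "\<lambda>a b. \<Sum>k\<in>K. c k * g k a b"] by simp
qed (auto simp: linear_op_zero[OF assms])

text \<open>Horner's scheme for \<open>\<phi>(T) g\<close>, so that facts about it follow by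
  induction over \<open>pCons\<close>.\<close>

definition poly_op :: "real poly \<Rightarrow> (biform \<Rightarrow> biform) \<Rightarrow> biform \<Rightarrow> biform" where
  "poly_op \<phi> T g = fold_coeffs (\<lambda>c h a b. c * g a b + T h a b) \<phi> (\<lambda>a b. 0)"

lemma poly_op_0 [simp]: "poly_op 0 T g = (\<lambda>a b. 0)"
  by (simp add: poly_op_def)

lemma poly_op_pCons:
  "linear_op T \<Longrightarrow> poly_op (pCons c \<phi>) T g = (\<lambda>a b. c * g a b + T (poly_op \<phi> T g) a b)"
  by (cases "\<phi> = 0 \<and> c = 0") (auto simp: poly_op_def linear_op_zero)

lemma poly_op_add:
  assumes "linear_op T"
  shows "poly_op (\<phi> + \<psi>) T g = (\<lambda>a b. poly_op \<phi> T g a b + poly_op \<psi> T g a b)"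
proof (induction \<phi> \<psi> rule: poly_induct2)
  case (pCons a p b q)
  then show ?case
    by (simp add: poly_op_pCons[OF assms] linear_op_add[OF assms] algebra_simps)
qed simp

lemma poly_op_smult:
  assumes "linear_op T"
  shows "poly_op (smult c \<phi>) T g = (\<lambda>a b. c * poly_op \<phi> T g a b)"
proof (induction \<phi>)
  case (pCons a p)
  then show ?case
    by (simp add: poly_op_pCons[OF assms] linear_op_scale[OF assms] algebra_simps)
qed simp

lemma poly_op_linear_factor:
  assumes "linear_op T"
  shows "poly_op ([:c, d:] * \<phi>) T g = (\<lambda>a b. c * poly_op \<phi> T g a b + d * T (poly_op \<phi> T g) a b)"
  by (simp add: poly_op_add[OF assms] poly_op_smult[OF assms] poly_op_pCons[OF assms]
      linear_op_scale[OF assms])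

text \<open>Lets \<open>cayley\<close> and \<open>bracket_mult\<close> pass through polynomials in
  an operator that changes with the bidegree; with \<open>S = T\<close> it says that
  \<open>T\<close> commutes with its own polynomials.\<close>

lemma poly_op_intertwine:
  assumes "linear_op T" "linear_op T'" "linear_op S" "\<And>h. S (T h) = T' (S h)"
  shows "S (poly_op \<phi> T g) = poly_op \<phi> T' (S g)"
proof (induction \<phi>)
  case (pCons a p)
  show ?case
    using linear_opD[OF assms(3), of a g 1 "T (poly_op p T g)"] pCons
    by (simp add: poly_op_pCons[OF assms(1)] poly_op_pCons[OF assms(2)] assms(4))
qed (simp add: linear_op_zero[OF assms(3)])

lemma linear_op_shift: "linear_op T \<Longrightarrow> linear_op (\<lambda>h a b. c * h a b + T h a b)"
  by (simp add: linear_op_def algebra_simps)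

lemma linear_op_comp: "linear_op S \<Longrightarrow> linear_op T \<Longrightarrow> linear_op (\<lambda>h. S (T h))"
  by (simp add: linear_op_def)

lemma poly_op_shift:
  assumes "linear_op T"
  shows "poly_op \<phi> (\<lambda>h a b. c * h a b + T h a b) g = poly_op (pcompose \<phi> [:c, 1:]) T g"
proof (induction \<phi>)
  case (pCons a p)
  have "poly_op [:a:] T g = (\<lambda>u v. a * g u v)"
    by (simp add: poly_op_pCons[OF assms] linear_op_zero[OF assms])
  then show ?case using pCons
    by (simp only: poly_op_pCons[OF linear_op_shift[OF assms]] pcompose_pCons poly_op_add[OF assms]
        poly_op_linear_factor[OF assms]) simp
qed simp

lemma linear_op_poly_op:
  assumes "linear_op T"
  shows "linear_op (poly_op \<phi> T)"
  unfolding linear_op_def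
proof (intro allI)
  fix f g c d
  show "poly_op \<phi> T (\<lambda>a b. c * f a b + d * g a b)
      = (\<lambda>a b. c * poly_op \<phi> T f a b + d * poly_op \<phi> T g a b)"
    by (induction \<phi>) (simp_all add: poly_op_pCons[OF assms] linear_opD[OF assms] algebra_simps)
qed

lemma poly_op_kernel:
  assumes "linear_op T" "T g = (\<lambda>a b. 0)"
  shows "poly_op \<phi> T g = (\<lambda>a b. poly \<phi> 0 * g a b)"
proof (cases \<phi>)
  case (pCons c p)
  have "T (poly_op p T g) = poly_op p T (T g)"
    by (rule poly_op_intertwine) (use assms in auto)
  also have "\<dots> = (\<lambda>a b. 0)"
    by (simp add: assms(2) linear_op_zero[OF linear_op_poly_op[OF assms(1)]])
  finally show ?thesis by (simp add: pCons poly_op_pCons[OF assms(1)])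
qed

section \<open>Cayley's operator and the Casimir operator\<close>

text \<open>Multiplication by \<open>s\<^sub>1 t\<^sub>2 - t\<^sub>1 s\<^sub>2\<close>, and \<open>\<partial>\<^sub>s\<^sub>1 \<partial>\<^sub>t\<^sub>2 - \<partial>\<^sub>t\<^sub>1 \<partial>\<^sub>s\<^sub>2\<close> on bidegree \<open>(n, n)\<close>.\<close>
definition bracket_mult :: "biform \<Rightarrow> biform" where
  "bracket_mult g a b = (if a = 0 then 0 else g (a - 1) b) - (if b = 0 then 0 else g a (b - 1))"

definition cayley :: "nat \<Rightarrow> biform \<Rightarrow> biform" where
  "cayley n g a b = (real a + 1) * (real n - real b) * g (Suc a) b
     - (real n - real a) * (real b + 1) * g a (Suc b)"

abbreviation casimir :: "nat \<Rightarrow> biform \<Rightarrow> biform" where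
  "casimir n g \<equiv> bracket_mult (cayley n g)"

lemma linear_bracket_mult: "linear_op bracket_mult"
  by (auto simp: linear_op_def bracket_mult_def fun_eq_iff algebra_simps)

lemma linear_cayley: "linear_op (cayley n)"
  by (auto simp: linear_op_def cayley_def fun_eq_iff algebra_simps)

lemma linear_casimir: "linear_op (casimir n)"
  by (rule linear_op_comp[OF linear_bracket_mult linear_cayley])

text \<open>The commutator of \<Omega> and X is the sum of the two Euler operators plus 2, and each
  Euler operator acts as n in bidegree (n, n).\<close>

lemma cayley_bracket_mult:
  "cayley (Suc n) (bracket_mult g) = (\<lambda>a b. 2 * real (Suc n) * g a b + casimir n g a b)"
proof (intro ext)
  fix a b
  show "cayley (Suc n) (bracket_mult g) a b = 2 * real (Suc n) * g a b + casimir n g a b"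
    by (cases a; cases b) (simp_all add: cayley_def bracket_mult_def algebra_simps)
qed

text \<open>A coefficient with a > n or b > n would belong to a negative power of a
  variable.\<close>

definition bidegree_le :: "nat \<Rightarrow> biform \<Rightarrow> bool" where
  "bidegree_le n g \<longleftrightarrow> (\<forall>a b. n < a \<or> n < b \<longrightarrow> g a b = 0)"

text \<open>At the border index \<open>Suc n\<close> the weight
  \<open>real (Suc n) - real a\<close>, or its analogue for \<open>b\<close>, vanishes; beyond it
  the coefficients of \<open>g\<close> do.\<close>

lemma bidegree_le_cayley: "bidegree_le (Suc n) g \<Longrightarrow> bidegree_le n (cayley (Suc n) g)"
  unfolding bidegree_le_def cayley_def
  apply safe
  subgoal for a b by (cases "a = Suc n") auto
  subgoal for a b by (cases "b = Suc n") auto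
  done

lemma bidegree_le_bracket_mult: "bidegree_le n g \<Longrightarrow> bidegree_le (Suc n) (bracket_mult g)"
  by (auto simp: bidegree_le_def bracket_mult_def)

lemma cayley_bidegree_0: "bidegree_le 0 g \<Longrightarrow> cayley 0 g = (\<lambda>a b. 0)"
  by (auto simp: bidegree_le_def cayley_def fun_eq_iff)

lemma bidegree_le_casimir: "bidegree_le n g \<Longrightarrow> bidegree_le n (casimir n g)"
proof (cases n)
  case 0
  assume "bidegree_le n g"
  then have "cayley n g = (\<lambda>a b. 0)"
    by (simp add: 0 cayley_bidegree_0)
  then show ?thesis by (simp add: linear_op_zero[OF linear_bracket_mult] bidegree_le_def)
qed (auto intro: bidegree_le_cayley bidegree_le_bracket_mult)

lemma bidegree_le_poly_op:
  "bidegree_le n g \<Longrightarrow> bidegree_le n (poly_op \<phi> (casimir n) g)"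
proof (induction \<phi>)
  case (pCons a p)
  then show ?case using bidegree_le_casimir[of n "poly_op p (casimir n) g"]
    by (simp add: poly_op_pCons[OF linear_casimir] bidegree_le_def)
qed (simp add: bidegree_le_def)

section \<open>The Bombieri inner product of biforms\<close>

definition pairing :: "nat \<Rightarrow> biform \<Rightarrow> biform \<Rightarrow> real" where
  "pairing n f g = (\<Sum>a\<le>n. \<Sum>b\<le>n. f a b * g a b / (real (n choose a) * real (n choose b)))"

lemma pairing_commute: "pairing n f g = pairing n g f"
  by (simp add: pairing_def mult.commute)

lemma pairing_sum_left:
  "pairing n (\<lambda>a b. \<Sum>k\<in>K. c k * g k a b) h = (\<Sum>k\<in>K. c k * pairing n (g k) h)"
proof (induction K rule: infinite_finite_induct)
  case (insert k K)
  then show ?case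
    by (simp add: pairing_def sum.distrib sum_distrib_left algebra_simps add_divide_distrib)
qed (auto simp: pairing_def)

lemma pairing_sum_right:
  "pairing n h (\<lambda>a b. \<Sum>k\<in>K. c k * g k a b) = (\<Sum>k\<in>K. c k * pairing n h (g k))"
  by (simp add: pairing_commute[of n h] pairing_sum_left)

lemma pairing_lincomb_left:
  "pairing n (\<lambda>a b. c * f a b + d * g a b) h = c * pairing n f h + d * pairing n g h"
  by (simp add: pairing_def sum.distrib sum_distrib_left algebra_simps add_divide_distrib)

text \<open>These ratios of the weights \<open>1 / (n choose k)\<close> make multiplication by s or
  t adjoint to the matching derivative divided by \<open>Suc n\<close>.\<close>

lemma binomial_Suc_weights:
  assumes "k \<le> n"
  shows "1 / real (Suc n choose Suc k) = (real k + 1) / (real (Suc n) * real (n choose k))"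
    and "1 / real (Suc n choose k) = (real (Suc n) - real k) / (real (Suc n) * real (n choose k))"
proof -
  have pos: "real (n choose k) > 0" "real (Suc n choose k) > 0" "real (Suc n choose Suc k) > 0"
    using assms by (simp_all del: binomial_Suc_Suc add: zero_less_binomial)
  have "real (Suc k) * real (Suc n choose Suc k) = real (Suc n) * real (n choose k)"
    by (metis Suc_times_binomial_eq mult.commute of_nat_mult)
  then show "1 / real (Suc n choose Suc k) = (real k + 1) / (real (Suc n) * real (n choose k))"
    using pos by (subst frac_eq_eq) (simp_all add: add.commute del: binomial_Suc_Suc)
  have "(Suc n - k) * (Suc n choose k) = Suc n * (n choose k)"
    using assms binomial_absorb_comp[of "Suc n" k] by simp
  then have "(real (Suc n) - real k) * real (Suc n choose k) = real (Suc n) * real (n choose k)"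
    using assms by (metis le_SucI of_nat_diff of_nat_mult)
  then show "1 / real (Suc n choose k) = (real (Suc n) - real k) / (real (Suc n) * real (n choose k))"
    using pos by (subst frac_eq_eq) (simp_all del: binomial_Suc_Suc of_nat_Suc)
qed

text \<open>Adjointness of X and \<Omega>: each pair of variables contributes one factor
  \<open>1 / Suc n\<close>. The bound on \<open>f\<close> removes the boundary terms at index
  \<open>Suc n\<close>.\<close>

lemma pairing_bracket_mult:
  assumes "bidegree_le n f"
  shows "pairing (Suc n) (bracket_mult f) g = pairing n f (cayley (Suc n) g) / (real (Suc n))\<^sup>2"
proof -
  define W where "W a b = 1 / (real (Suc n choose a) * real (Suc n choose b))" for a b
  have factor: "F * (x * (u / d / s) - y * (v / d / s)) = F * (u * x - v * y) / d / s"
    for F x y u v d s :: real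
    by (simp add: diff_divide_distrib algebra_simps)
  have f0: "f a (Suc n) = 0" "f (Suc n) a = 0" for a
    using assms by (auto simp: bidegree_le_def)
  have A: "(\<Sum>a\<le>Suc n. \<Sum>b\<le>Suc n. (if a = 0 then 0 else f (a - 1) b) * g a b * W a b)
      = (\<Sum>a\<le>n. \<Sum>b\<le>n. f a b * g (Suc a) b * W (Suc a) b)"
    by (subst sum.atMost_Suc_shift) (simp add: f0)
  have B: "(\<Sum>a\<le>Suc n. \<Sum>b\<le>Suc n. (if b = 0 then 0 else f a (b - 1)) * g a b * W a b)
      = (\<Sum>a\<le>n. \<Sum>b\<le>n. f a b * g a (Suc b) * W a (Suc b))"
    by (subst sum.atMost_Suc_shift) (simp add: f0)
  have "pairing (Suc n) (bracket_mult f) g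
      = (\<Sum>a\<le>n. \<Sum>b\<le>n. f a b * g (Suc a) b * W (Suc a) b)
        - (\<Sum>a\<le>n. \<Sum>b\<le>n. f a b * g a (Suc b) * W a (Suc b))"
    unfolding A[symmetric] B[symmetric]
    unfolding pairing_def bracket_mult_def W_def
    by (simp only: left_diff_distrib sum_subtractf times_divide_eq_right mult_1_right diff_divide_distrib)
  also have "\<dots> = (\<Sum>a\<le>n. \<Sum>b\<le>n. f a b * (g (Suc a) b * W (Suc a) b - g a (Suc b) * W a (Suc b)))"
    by (simp add: algebra_simps sum_subtractf)
  also have "\<dots> = (\<Sum>a\<le>n. \<Sum>b\<le>n. f a b * cayley (Suc n) g a b
      / (real (n choose a) * real (n choose b)) / (real (Suc n))\<^sup>2)"
  proof (intro sum.cong refl)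
    fix a b assume "a \<in> {..n}" "b \<in> {..n}"
    then have ab: "a \<le> n" "b \<le> n" by auto
    have "W (Suc a) b = (1 / real (Suc n choose Suc a)) * (1 / real (Suc n choose b))"
      "W a (Suc b) = (1 / real (Suc n choose a)) * (1 / real (Suc n choose Suc b))"
      by (simp_all add: W_def)
    then have W: "W (Suc a) b = (real a + 1) * (real (Suc n) - real b)
          / (real (n choose a) * real (n choose b)) / (real (Suc n))\<^sup>2"
      "W a (Suc b) = (real (Suc n) - real a) * (real b + 1)
          / (real (n choose a) * real (n choose b)) / (real (Suc n))\<^sup>2"
      using binomial_Suc_weights[OF ab(1)] binomial_Suc_weights[OF ab(2)]
      by (simp_all add: power2_eq_square field_simps del: of_nat_Suc binomial_Suc_Suc)
    show "f a b * (g (Suc a) b * W (Suc a) b - g a (Suc b) * W a (Suc b))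
      = f a b * cayley (Suc n) g a b / (real (n choose a) * real (n choose b)) / (real (Suc n))\<^sup>2"
      unfolding W cayley_def by (rule factor)
  qed
  finally show ?thesis
    by (simp add: pairing_def sum_divide_distrib del: of_nat_Suc)
qed

section \<open>Products of linear forms\<close>

text \<open>The biform p \<otimes> p, with p homogenised to the ambient degree.\<close>

definition form_square :: "real poly \<Rightarrow> biform" where
  "form_square p a b = coeff p a * coeff p b"

text \<open>Dehomogenised at t = 1. The formal degree is \<open>card I\<close> even if some
  \<open>x i\<close> vanish.\<close>

definition linear_product :: "('i \<Rightarrow> real) \<Rightarrow> ('i \<Rightarrow> real) \<Rightarrow> 'i set \<Rightarrow> real poly" where
  "linear_product x z I = (\<Prod>i\<in>I. [:z i, x i:])"

lemma linear_product_remove: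
  "finite I \<Longrightarrow> i \<in> I \<Longrightarrow> linear_product x z I = [:z i, x i:] * linear_product x z (I - {i})"
  by (simp add: linear_product_def prod.remove)

lemma degree_linear_product: "degree (linear_product x z I) \<le> card I"
proof (cases "finite I")
  case True
  have "degree (linear_product x z I) \<le> (\<Sum>i\<in>I. degree [:z i, x i:])"
    unfolding linear_product_def
    by (rule order_trans[OF degree_prod_sum_le[OF True]]) (simp only: o_def order_refl)
  also have "\<dots> \<le> (\<Sum>i\<in>I. 1)" by (rule sum_mono) simp
  finally show ?thesis by simp
qed (simp add: linear_product_def)

lemma bidegree_le_form_square:
  "bidegree_le (card I) (form_square (linear_product x z I))"
  using degree_linear_product[of x z I]
  by (auto simp: bidegree_le_def form_square_def coeff_eq_0)

lemma coeff_linear_product_fst_derivative: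
  assumes "finite I"
  shows "(real a + 1) * coeff (linear_product x z I) (Suc a)
    = (\<Sum>i\<in>I. x i * coeff (linear_product x z (I - {i})) a)"
proof -
  have "pderiv (linear_product x z I) = (\<Sum>i\<in>I. linear_product x z (I - {i}) * [:x i:])"
    unfolding linear_product_def pderiv_prod by (simp add: pderiv_pCons)
  then have "coeff (pderiv (linear_product x z I)) a
      = (\<Sum>i\<in>I. x i * coeff (linear_product x z (I - {i})) a)"
    by (simp add: coeff_sum mult.commute)
  then show ?thesis by (simp add: coeff_pderiv add.commute)
qed

text \<open>These are the coefficients of the t-derivative of p. Summing
  \<open>p = l\<^sub>i (p / l\<^sub>i)\<close> over the factors and subtracting s times the
  s-derivative is Euler's identity.\<close>

lemma coeff_linear_product_snd_derivative:
  assumes "finite I"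
  shows "(real (card I) - real b) * coeff (linear_product x z I) b
    = (\<Sum>i\<in>I. z i * coeff (linear_product x z (I - {i})) b)"
proof -
  have "real (card I) * coeff (linear_product x z I) b
      = (\<Sum>i\<in>I. coeff ([:z i, x i:] * linear_product x z (I - {i})) b)"
    by (simp only: linear_product_remove[OF assms, symmetric] cong: sum.cong) simp
  also have "\<dots> = (\<Sum>i\<in>I. z i * coeff (linear_product x z (I - {i})) b)
      + (case b of 0 \<Rightarrow> 0 | Suc c \<Rightarrow> \<Sum>i\<in>I. x i * coeff (linear_product x z (I - {i})) c)"
    by (cases b) (simp_all add: sum.distrib)
  also have "(case b of 0 \<Rightarrow> 0 | Suc c \<Rightarrow> \<Sum>i\<in>I. x i * coeff (linear_product x z (I - {i})) c)
      = real b * coeff (linear_product x z I) b"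
    using coeff_linear_product_fst_derivative[OF assms, of _ x z]
    by (auto split: nat.split simp: add.commute)
  finally show ?thesis by (simp add: algebra_simps)
qed

definition plane_det :: "('i \<Rightarrow> real) \<Rightarrow> ('i \<Rightarrow> real) \<Rightarrow> 'i \<times> 'i \<Rightarrow> real" where
  "plane_det x z k = x (fst k) * z (snd k) - z (fst k) * x (snd k)"

lemma cayley_form_square:
  assumes "finite I"
  shows "cayley (card I) (form_square (linear_product x z I))
    = bracket_mult (\<lambda>a b. \<Sum>k\<in>I \<times> I. - ((plane_det x z k)\<^sup>2 / 2)
        * form_square (linear_product x z (I - {fst k, snd k})) a b)"
proof (intro ext)
  fix a b
  let ?p = "\<lambda>i. linear_product x z (I - {i})"
  let ?r = "\<lambda>k. linear_product x z (I - {fst k, snd k})"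
  let ?E = "\<lambda>k. plane_det x z k * (coeff (?p (fst k)) a * coeff (?p (snd k)) b)"
  have "cayley (card I) (form_square (linear_product x z I)) a b
      = ((real a + 1) * coeff (linear_product x z I) (Suc a))
          * ((real (card I) - real b) * coeff (linear_product x z I) b)
        - ((real (card I) - real a) * coeff (linear_product x z I) a)
          * ((real b + 1) * coeff (linear_product x z I) (Suc b))"
    by (simp add: cayley_def form_square_def algebra_simps)
  also have "\<dots> = (\<Sum>k\<in>I \<times> I. ?E k)"
    unfolding coeff_linear_product_fst_derivative[OF assms] coeff_linear_product_snd_derivative[OF assms]
    by (simp only: sum_product sum.cartesian_product sum_subtractf[symmetric] case_prod_beta)
      (simp add: plane_det_def algebra_simps)
  \<comment> \<open>The bracket changes sign under the swap, so symmetrising leaves it times the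
    difference of two tensor products.\<close>
  also have "\<dots> = (\<Sum>k\<in>I \<times> I. (?E k + ?E (prod.swap k)) / 2)"
  proof -
    have "(\<Sum>k\<in>I \<times> I. ?E (prod.swap k)) = (\<Sum>k\<in>I \<times> I. ?E k)"
      by (rule sum.reindex_bij_witness[of _ prod.swap prod.swap]) auto
    then show ?thesis by (simp add: sum.distrib flip: sum_divide_distrib)
  qed
  also have "\<dots> = (\<Sum>k\<in>I \<times> I. - ((plane_det x z k)\<^sup>2 / 2) * bracket_mult (form_square (?r k)) a b)"
  proof (intro sum.cong refl)
    fix k assume "k \<in> I \<times> I"
    then obtain i j where k: "k = (i, j)" "i \<in> I" "j \<in> I" by auto
    show "(?E k + ?E (prod.swap k)) / 2
      = - ((plane_det x z k)\<^sup>2 / 2) * bracket_mult (form_square (?r k)) a b"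
    proof (cases "i = j")
      case True
      then show ?thesis by (simp add: k plane_det_def)
    next
      case False
      \<comment> \<open>With r the product of the remaining factors, the difference is
        \<open>(l\<^sub>j \<otimes> l\<^sub>i - l\<^sub>i \<otimes> l\<^sub>j) (r \<otimes>
        r)\<close>, and its first factor is minus the bracket of \<open>l\<^sub>i\<close> and
        \<open>l\<^sub>j\<close> times X.\<close>
      then have "?p i = [:z j, x j:] * ?r k" "?p j = [:z i, x i:] * ?r k"
        using linear_product_remove[of "I - {i}" j x z] linear_product_remove[of "I - {j}" i x z]
          assms k by (auto simp: Diff_insert2[symmetric] insert_commute)
      then have c: "coeff (?p i) c = z j * coeff (?r k) c + x j * (if c = 0 then 0 else coeff (?r k) (c - 1))"
        "coeff (?p j) c = z i * coeff (?r k) c + x i * (if c = 0 then 0 else coeff (?r k) (c - 1))" for c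
        by (cases c; simp)+
      show ?thesis
        using c by (simp add: k plane_det_def bracket_mult_def form_square_def)
          (simp add: algebra_simps power2_eq_square)
    qed
  qed
  also have "\<dots> = bracket_mult (\<lambda>a b. \<Sum>k\<in>I \<times> I. - ((plane_det x z k)\<^sup>2 / 2)
        * form_square (?r k) a b) a b"
    by (subst linear_op_sum[OF linear_bracket_mult]) simp
  finally show "cayley (card I) (form_square (linear_product x z I)) a b
      = bracket_mult (\<lambda>a b. \<Sum>k\<in>I \<times> I. - ((plane_det x z k)\<^sup>2 / 2)
        * form_square (?r k) a b) a b" .
qed

lemma pairing_form_square:
  "pairing n (form_square p) (form_square q) = (\<Sum>a\<le>n. coeff p a * coeff q a / real (n choose a))\<^sup>2"
  by (simp add: pairing_def form_square_def power2_eq_square sum_product algebra_simps)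

section \<open>Positivity for polynomials in the Casimir operator\<close>

text \<open>The eigenvalue of X \<Omega> on X^j h for h of bidegree (n - j, n - j) with \<Omega> h =
  0: the sum of the commutation constants 2 m over n - j < m \<le> n.\<close>

definition casimir_root :: "nat \<Rightarrow> nat \<Rightarrow> real" where
  "casimir_root n j = real j * (2 * real n + 1 - real j)"

text \<open>Lowering both indices by two costs the two commutation constants 2 n + 2 and 2 n +
  4.\<close>

lemma casimir_root_shift:
  "casimir_root (Suc (Suc n)) (Suc (Suc j)) = casimir_root n j + (4 * real n + 6)"
  by (simp add: casimir_root_def algebra_simps)

text \<open>Beyond the constant term, one X passes by adjointness to the right as \<Omega>. This
  leaves X S on the right and, on the left, X times a polynomial in T applied to R; a second
  adjunction produces \<Omega> X = 2 n + 2 + T. The minus signs of \<open>R\<close> and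
  \<open>S\<close> cancel and their halves give the 4.\<close>

lemma casimir_pairing_step:
  fixes x z :: "'i \<Rightarrow> real" and y w :: "'j \<Rightarrow> real"
  assumes I: "finite I" "card I = Suc (Suc n)" and J: "finite J" "card J = Suc (Suc n)"
  shows "pairing (Suc (Suc n)) (poly_op (pCons c \<phi>) (casimir (Suc (Suc n))) (form_square (linear_product x z I)))
      (form_square (linear_product y w J))
    = c * pairing (Suc (Suc n)) (form_square (linear_product x z I)) (form_square (linear_product y w J))
      + (\<Sum>k\<in>I \<times> I. \<Sum>l\<in>J \<times> J. (plane_det x z k)\<^sup>2 * (plane_det y w l)\<^sup>2
          / (4 * (real (Suc (Suc n)))\<^sup>2 * (real (Suc n))\<^sup>2)
          * pairing n (poly_op ([:2 * real n + 2, 1:] * pcompose \<phi> [:4 * real n + 6, 1:]) (casimir n)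
              (form_square (linear_product x z (I - {fst k, snd k}))))
            (form_square (linear_product y w (J - {fst l, snd l}))))"
proof -
  let ?N = "Suc (Suc n)"
  define F where "F = form_square (linear_product x z I)"
  define G where "G = form_square (linear_product y w J)"
  define f where "f k = form_square (linear_product x z (I - {fst k, snd k}))" for k
  define g where "g k = form_square (linear_product y w (J - {fst k, snd k}))" for k
  define u where "u k = - ((plane_det x z k)\<^sup>2 / 2)" for k
  define v where "v k = - ((plane_det y w k)\<^sup>2 / 2)" for k
  define R where "R a b = (\<Sum>k\<in>I \<times> I. u k * f k a b)" for a b
  define S where "S a b = (\<Sum>k\<in>J \<times> J. v k * g k a b)" for a b
  define \<phi>' where "\<phi>' = pcompose \<phi> [:4 * real n + 6, 1:]"
  define \<psi> where "\<psi> = [:2 * real n + 2, 1:] * \<phi>'"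
  have F: "cayley ?N F = bracket_mult R"
    using cayley_form_square[OF I(1), of x z] unfolding I(2) F_def R_def u_def f_def .
  have G: "cayley ?N G = bracket_mult S"
    using cayley_form_square[OF J(1), of y w] unfolding J(2) G_def S_def v_def g_def .
  have supF: "bidegree_le ?N F" using bidegree_le_form_square[of I x z] by (simp add: F_def I)
  have supR: "bidegree_le n R"
  proof -
    \<comment> \<open>A diagonal pair leaves n + 1 factors, one too many for bidegree (n, n), but
      its coefficient is zero.\<close>
    have "u k * f k a b = 0" if "k \<in> I \<times> I" "n < a \<or> n < b" for k a b
    proof (cases "fst k = snd k")
      case True
      then show ?thesis by (simp add: u_def plane_det_def)
    next
      case False
      then have "card (I - {fst k, snd k}) = n"
        using that I by (auto simp: card_Diff_subset)
      then show ?thesis using bidegree_le_form_square[of "I - {fst k, snd k}" x z] that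
        by (auto simp: f_def bidegree_le_def)
    qed
    then show ?thesis by (auto simp: bidegree_le_def R_def intro!: sum.neutral)
  qed
  define T where "T = (\<lambda>h. cayley ?N (bracket_mult h))"
  have linT: "linear_op T"
    unfolding T_def by (rule linear_op_comp[OF linear_cayley linear_bracket_mult])
  have "cayley ?N (poly_op \<phi> (casimir ?N) F) = poly_op \<phi> T (bracket_mult R)"
    using poly_op_intertwine[OF linear_casimir linT linear_cayley, of ?N ?N \<phi> F]
    by (simp add: T_def F)
  \<comment> \<open>Commuting twice gives (\<Omega> X) X = X (4 n + 6 + X \<Omega>) in bidegree (n,
    n).\<close>
  also have "\<dots> = bracket_mult (poly_op \<phi> (\<lambda>h a b. (4 * real n + 6) * h a b + casimir n h a b) R)"
  proof (rule poly_op_intertwine[symmetric, OF _ linT linear_bracket_mult])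
    show "linear_op (\<lambda>h a b. (4 * real n + 6) * h a b + casimir n h a b)"
      by (rule linear_op_shift[OF linear_casimir])
    fix h
    have 1: "bracket_mult (\<lambda>a b. (4 * real n + 6) * h a b + casimir n h a b)
      = (\<lambda>a b. (4 * real n + 6) * bracket_mult h a b + bracket_mult (casimir n h) a b)"
      using linear_opD[OF linear_bracket_mult, of "4 * real n + 6" h 1 "casimir n h"] by simp
    have 2: "bracket_mult (cayley (Suc n) (bracket_mult h))
      = (\<lambda>a b. (2 * real (Suc n)) * bracket_mult h a b + bracket_mult (casimir n h) a b)"
      using linear_opD[OF linear_bracket_mult, of "2 * real (Suc n)" h 1 "casimir n h"]
      by (simp add: cayley_bracket_mult)
    show "bracket_mult (\<lambda>a b. (4 * real n + 6) * h a b + casimir n h a b) = T (bracket_mult h)"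
      unfolding T_def 1 cayley_bracket_mult[of "Suc n" "bracket_mult h"] 2
      by (simp add: fun_eq_iff algebra_simps)
  qed
  also have "poly_op \<phi> (\<lambda>h a b. (4 * real n + 6) * h a b + casimir n h a b) R = poly_op \<phi>' (casimir n) R"
    unfolding \<phi>'_def by (rule poly_op_shift[OF linear_casimir])
  finally have E: "cayley ?N (poly_op \<phi> (casimir ?N) F) = bracket_mult (poly_op \<phi>' (casimir n) R)" .
  have sup1: "bidegree_le n (poly_op \<phi>' (casimir n) R)"
    by (rule bidegree_le_poly_op[OF supR])
  have "pairing ?N (casimir ?N (poly_op \<phi> (casimir ?N) F)) G
      = pairing (Suc n) (bracket_mult (poly_op \<phi>' (casimir n) R)) (cayley ?N G) / (real ?N)\<^sup>2"
    unfolding E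
    by (rule pairing_bracket_mult) (rule bidegree_le_bracket_mult[OF sup1])
  also have "pairing (Suc n) (bracket_mult (poly_op \<phi>' (casimir n) R)) (cayley ?N G)
      = pairing (Suc n) (bracket_mult S) (bracket_mult (poly_op \<phi>' (casimir n) R))"
    by (simp add: G pairing_commute)
  also have "\<dots> = pairing n S (cayley (Suc n) (bracket_mult (poly_op \<phi>' (casimir n) R))) / (real (Suc n))\<^sup>2"
  proof (rule pairing_bracket_mult)
    have "v k * g k a b = 0" if "k \<in> J \<times> J" "n < a \<or> n < b" for k a b
    proof (cases "fst k = snd k")
      case True
      then show ?thesis by (simp add: v_def plane_det_def)
    next
      case False
      then have "card (J - {fst k, snd k}) = n"
        using that J by (auto simp: card_Diff_subset)
      then show ?thesis using bidegree_le_form_square[of "J - {fst k, snd k}" y w] that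
        by (auto simp: g_def bidegree_le_def)
    qed
    then show "bidegree_le n S" by (auto simp: bidegree_le_def S_def intro!: sum.neutral)
  qed
  also have "cayley (Suc n) (bracket_mult (poly_op \<phi>' (casimir n) R)) = poly_op \<psi> (casimir n) R"
    unfolding cayley_bracket_mult \<psi>_def poly_op_linear_factor[OF linear_casimir]
    by (simp add: fun_eq_iff algebra_simps)
  also have "poly_op \<psi> (casimir n) R = (\<lambda>a b. \<Sum>k\<in>I \<times> I. u k * poly_op \<psi> (casimir n) (f k) a b)"
    unfolding R_def by (rule linear_op_sum[OF linear_op_poly_op[OF linear_casimir]])
  also have "pairing n S \<dots> = (\<Sum>k\<in>I \<times> I. \<Sum>l\<in>J \<times> J. u k * v l * pairing n (poly_op \<psi> (casimir n) (f k)) (g l))"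
    unfolding S_def pairing_sum_left pairing_sum_right
    by (simp add: sum_distrib_left pairing_commute algebra_simps)
  finally have step: "pairing ?N (casimir ?N (poly_op \<phi> (casimir ?N) F)) G
    = (\<Sum>k\<in>I \<times> I. \<Sum>l\<in>J \<times> J. (plane_det x z k)\<^sup>2 * (plane_det y w l)\<^sup>2
          / (4 * (real ?N)\<^sup>2 * (real (Suc n))\<^sup>2) * pairing n (poly_op \<psi> (casimir n) (f k)) (g l))"
    by (simp add: u_def v_def sum_divide_distrib mult_ac del: of_nat_Suc)
  have "pairing ?N (poly_op (pCons c \<phi>) (casimir ?N) F) G
      = c * pairing ?N F G + pairing ?N (casimir ?N (poly_op \<phi> (casimir ?N) F)) G"
    using pairing_lincomb_left[of ?N c F 1 "casimir ?N (poly_op \<phi> (casimir ?N) F)" G]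
    by (simp add: poly_op_pCons[OF linear_casimir])
  then show ?thesis unfolding step
    by (simp only: F_def G_def f_def g_def \<psi>_def \<phi>'_def)
qed

text \<open>Each step removes two factors from p and from q and changes \<open>\<phi>\<close>, so
  only even indices occur. For n < 2 every bracket vanishes, T kills p \<otimes> p, and
  \<open>\<phi>(T)\<close> acts on it as \<open>\<phi>(0)\<close>.\<close>

lemma pairing_poly_casimir_nonneg:
  fixes x z :: "'i \<Rightarrow> real" and y w :: "'j \<Rightarrow> real"
  assumes "finite I" "card I = n" "finite J" "card J = n"
    and "0 \<le> poly \<phi> 0"
    and "\<And>i j. i \<le> j \<Longrightarrow> 2 * j \<le> n \<Longrightarrow> poly \<phi> (casimir_root n (2 * i)) \<le> poly \<phi> (casimir_root n (2 * j))"
  shows "0 \<le> pairing n (poly_op \<phi> (casimir n) (form_square (linear_product x z I)))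
      (form_square (linear_product y w J))"
  using assms
proof (induction n arbitrary: I J \<phi> rule: less_induct)
  case (less n)
  show ?case
  proof (cases "n < 2")
    case True
    have z: "plane_det x z k = 0" if "k \<in> I \<times> I" for k
    proof -
      have "fst k = snd k"
        using that True less.prems(1,2) card_le_Suc0_iff_eq[of I] by auto
      then show ?thesis by (simp add: plane_det_def)
    qed
    have "cayley n (form_square (linear_product x z I)) = (\<lambda>a b. 0)"
      using cayley_form_square[OF less.prems(1), of x z]
      by (simp add: less.prems(2) z linear_op_zero[OF linear_bracket_mult])
    then have "casimir n (form_square (linear_product x z I)) = (\<lambda>a b. 0)"
      by (simp add: linear_op_zero[OF linear_bracket_mult])
    then have "poly_op \<phi> (casimir n) (form_square (linear_product x z I))
        = (\<lambda>a b. poly \<phi> 0 * form_square (linear_product x z I) a b)"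
      by (rule poly_op_kernel[OF linear_casimir])
    then show ?thesis
      using pairing_lincomb_left[of n "poly \<phi> 0" "form_square (linear_product x z I)" 0 "\<lambda>a b. 0"]
        less.prems(5) by (simp add: pairing_form_square)
  next
    case False
    then obtain m where n: "n = Suc (Suc m)"
      by (metis One_nat_def Suc_lessI less_2_cases_iff not0_implies_Suc not_less_eq)
    obtain c \<phi>1 where \<phi>: "\<phi> = pCons c \<phi>1" by (cases \<phi>)
    define \<psi> where "\<psi> = [:2 * real m + 2, 1:] * pcompose \<phi>1 [:4 * real m + 6, 1:]"
    have c: "c = poly \<phi> 0" by (simp add: \<phi>)
    have \<psi>: "poly \<psi> t = (t + (2 * real m + 2)) / (t + (4 * real m + 6)) * (poly \<phi> (t + (4 * real m + 6)) - c)"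
      if "t \<ge> 0" for t
    proof -
      have "t + (4 * real m + 6) \<noteq> 0" using that by linarith
      moreover have "poly \<psi> t = (t + (2 * real m + 2)) * poly \<phi>1 (t + (4 * real m + 6))"
        by (simp add: \<psi>_def poly_pcompose algebra_simps)
      moreover have "poly \<phi> (t + (4 * real m + 6)) - c
          = (t + (4 * real m + 6)) * poly \<phi>1 (t + (4 * real m + 6))"
        by (simp add: \<phi>)
      ultimately show ?thesis by (metis nonzero_mult_div_cancel_left times_divide_times_eq mult.commute times_divide_eq_left)
    qed
    \<comment> \<open>The weight of \<open>\<phi>(t + 4 m + 6) - \<phi>(0)\<close> in
      \<open>\<psi>\<close>. Both factors are nonnegative and nondecreasing along the even roots,
      hence so is their product.\<close>
    define \<theta> where "\<theta> t = (t + (2 * real m + 2)) / (t + (4 * real m + 6))" for t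
    have root0: "casimir_root m (2 * i) \<ge> 0" if "2 * i \<le> m" for i
      using that by (simp add: casimir_root_def)
    have diff0: "poly \<phi> (casimir_root n (2 * Suc i)) - c \<ge> 0" if "2 * i \<le> m" for i
      using less.prems(6)[of 0 "Suc i"] that by (simp add: c n casimir_root_def)
    have \<psi>_root: "poly \<psi> (casimir_root m (2 * i))
        = \<theta> (casimir_root m (2 * i)) * (poly \<phi> (casimir_root n (2 * Suc i)) - c)" if "2 * i \<le> m" for i
      using \<psi>[OF root0[OF that]] by (simp add: n casimir_root_shift \<theta>_def)
    have \<psi>_0: "0 \<le> poly \<psi> 0"
      using \<psi>_root[of 0] diff0[of 0] by (simp add: \<theta>_def casimir_root_def)
    have \<psi>_mono: "poly \<psi> (casimir_root m (2 * i)) \<le> poly \<psi> (casimir_root m (2 * j))"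
      if ij: "i \<le> j" "2 * j \<le> m" for i j
    proof -
      have i: "2 * i \<le> m" using ij by simp
      have "real i \<le> real j" "2 * real j \<le> real m" using ij by linarith+
      \<comment> \<open>Half the difference of the two roots; the second factor is positive since 2
        i and 2 j are at most m.\<close>
      then have "(real j - real i) * (2 * real m + 1 - 2 * real i - 2 * real j) \<ge> 0"
        by (intro mult_nonneg_nonneg) linarith+
      then have root_le: "casimir_root m (2 * i) \<le> casimir_root m (2 * j)"
        by (simp add: casimir_root_def algebra_simps)
      have "\<theta> s = 1 - (2 * real m + 4) / (s + (4 * real m + 6))" if "s \<ge> 0" for s
        using that unfolding \<theta>_def by (simp add: field_simps add_nonneg_eq_0_iff)
      then have \<theta>_le: "\<theta> (casimir_root m (2 * i)) \<le> \<theta> (casimir_root m (2 * j))"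
        using root_le root0[OF i] root0[OF ij(2)] by (simp add: frac_le)
      have "0 \<le> \<theta> (casimir_root m (2 * j))"
        using root0[OF ij(2)] by (simp add: \<theta>_def)
      then show ?thesis
        unfolding \<psi>_root[OF i] \<psi>_root[OF ij(2)]
        using \<theta>_le diff0[OF i] less.prems(6)[of "Suc i" "Suc j"] ij
        by (intro mult_mono) (auto simp: n)
    qed
    have term_nonneg: "0 \<le> (plane_det x z k)\<^sup>2 * (plane_det y w l)\<^sup>2
          / (4 * (real (Suc (Suc m)))\<^sup>2 * (real (Suc m))\<^sup>2)
          * pairing m (poly_op \<psi> (casimir m) (form_square (linear_product x z (I - {fst k, snd k}))))
            (form_square (linear_product y w (J - {fst l, snd l})))"
      if "k \<in> I \<times> I" "l \<in> J \<times> J" for k l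
    proof (cases "fst k = snd k \<or> fst l = snd l")
      case True
      then show ?thesis by (auto simp: plane_det_def)
    next
      case False
      have "0 \<le> pairing m (poly_op \<psi> (casimir m) (form_square (linear_product x z (I - {fst k, snd k}))))
            (form_square (linear_product y w (J - {fst l, snd l})))"
      proof (rule less.IH[OF _ _ _ _ _ \<psi>_0 \<psi>_mono])
        show "card (I - {fst k, snd k}) = m" "card (J - {fst l, snd l}) = m"
          using that False less.prems(1-4) by (auto simp: card_Diff_subset n)
      qed (use n less.prems in auto)
      then show ?thesis by (intro mult_nonneg_nonneg) auto
    qed
    have "0 \<le> c * pairing n (form_square (linear_product x z I)) (form_square (linear_product y w J))"
      using less.prems(5) by (simp add: c pairing_form_square)
    then show ?thesis
      unfolding \<phi> n casimir_pairing_step[OF less.prems(1) less.prems(2)[unfolded n]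
          less.prems(3) less.prems(4)[unfolded n]] \<psi>_def[symmetric]
      by (intro add_nonneg_nonneg sum_nonneg term_nonneg) (simp_all add: n)
  qed
qed

section \<open>Projection onto the kernel of the Casimir operator\<close>

text \<open>The coefficients of the restriction to equal pairs of variables, where X
  vanishes.\<close>

definition diagonal :: "biform \<Rightarrow> nat \<Rightarrow> real" where
  "diagonal g c = (\<Sum>a\<le>c. g a (c - a))"

lemma diagonal_bracket_mult: "diagonal (bracket_mult g) c = 0"
proof (cases c)
  case (Suc d)
  have "(\<Sum>a\<le>c. if a = 0 then 0 else g (a - 1) (c - a)) = (\<Sum>a\<le>d. g a (d - a))"
    unfolding Suc by (subst sum.atMost_Suc_shift) simp
  moreover have "(\<Sum>a\<le>c. if c - a = 0 then 0 else g a (c - a - 1)) = (\<Sum>a\<le>d. g a (d - a))"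
    unfolding Suc by (subst sum.atMost_Suc) (auto intro!: sum.cong)
  ultimately show ?thesis
    by (simp add: diagonal_def bracket_mult_def sum_subtractf)
qed (simp add: diagonal_def bracket_mult_def)

lemma diagonal_poly_op: "diagonal (poly_op \<phi> (casimir n) g) c = poly \<phi> 0 * diagonal g c"
proof (cases \<phi>)
  case (pCons u p)
  have "diagonal (poly_op \<phi> (casimir n) g) c
      = u * diagonal g c + diagonal (casimir n (poly_op p (casimir n) g)) c"
    by (simp add: pCons poly_op_pCons[OF linear_casimir] diagonal_def sum.distrib sum_distrib_left)
  then show ?thesis by (simp add: pCons diagonal_bracket_mult)
qed

lemma diagonal_form_square: "diagonal (form_square p) c = coeff (p * p) c"
  by (simp add: diagonal_def form_square_def coeff_mult)

text \<open>For coefficients divided by their binomials, \<Omega> g = 0 becomes h(a + 1, b) = h(a, b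
  + 1) for a, b < n, so h is constant along antidiagonals.\<close>

lemma cayley_kernel_antidiagonal:
  assumes "bidegree_le n g" "cayley n g = (\<lambda>a b. 0)"
  obtains H where "\<And>a b. g a b = H (a + b) * (real (n choose a) * real (n choose b))"
proof -
  define h where "h a b = g a b / (real (n choose a) * real (n choose b))" for a b
  have step: "h (Suc a) b = h a (Suc b)" if ab: "a < n" "b < n" for a b
  proof -
    have pos: "real (n choose a) \<noteq> 0" "real (n choose b) \<noteq> 0" "real (n choose Suc a) \<noteq> 0"
      "real (n choose Suc b) \<noteq> 0" "real n - real a \<noteq> 0" "real n - real b \<noteq> 0"
      "real a + 1 \<noteq> 0" "real b + 1 \<noteq> 0"
      using ab by auto
    have binom: "(real k + 1) * real (n choose Suc k) = (real n - real k) * real (n choose k)" if "k < n" for k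
    proof -
      have "Suc k * (n choose Suc k) = (n - k) * (n choose k)"
        using binomial_absorption[of k n] binomial_absorb_comp[of n k] by simp
      then have "real (Suc k) * real (n choose Suc k) = real (n - k) * real (n choose k)"
        by (metis of_nat_mult)
      then show ?thesis using that by (simp add: of_nat_diff add.commute)
    qed
    have "cayley n g a b = 0" by (simp add: assms(2))
    then have "(real a + 1) * (real n - real b) * g (Suc a) b = (real n - real a) * (real b + 1) * g a (Suc b)"
      by (simp add: cayley_def)
    then have "((real a + 1) * (real b + 1)) * (g (Suc a) b * (real (n choose a) * real (n choose Suc b)))
        = ((real a + 1) * (real b + 1)) * (g a (Suc b) * (real (n choose Suc a) * real (n choose b)))"
      using binom[OF ab(1)] binom[OF ab(2)] by algebra
    then have "g (Suc a) b * (real (n choose a) * real (n choose Suc b))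
        = g a (Suc b) * (real (n choose Suc a) * real (n choose b))"
      using pos by simp
    then show ?thesis
      unfolding h_def using pos by (simp add: frac_eq_eq)
  qed
  have shift: "h (a + k) (b - k) = h a b" if "a + k \<le> n" "k \<le> b" "b \<le> n" for a b k
    using that
  proof (induction k)
    case (Suc k)
    then show ?case using step[of "a + k" "b - Suc k"] by (simp add: Suc_diff_Suc)
  qed simp
  \<comment> \<open>The representative with the largest admissible first index, reached from (a, b)
    by shifts.\<close>
  define H where "H c = h (min c n) (c - min c n)" for c
  have "g a b = H (a + b) * (real (n choose a) * real (n choose b))" for a b
  proof (cases "a \<le> n \<and> b \<le> n")
    case True
    then have "H (a + b) = h a b"
      using shift[of a "min (a + b) n - a" b] by (auto simp: H_def min_def add.commute[of a b])
    then show ?thesis using True by (simp add: h_def)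
  next
    case False
    then show ?thesis using assms(1) by (auto simp: bidegree_le_def)
  qed
  then show ?thesis by (rule that)
qed

text \<open>A biform killed by \<Omega> is the polarisation of its diagonal restriction, so pairing
  it with q \<otimes> q is the Bombieri product of that restriction with q^2 in degree 2 n;
  Vandermonde's identity supplies the weights.\<close>

lemma pairing_cayley_kernel:
  assumes "bidegree_le n g" "cayley n g = (\<lambda>a b. 0)" "degree q \<le> n"
  shows "pairing n g (form_square q) = (\<Sum>c\<le>2 * n. diagonal g c * coeff (q * q) c / real (2 * n choose c))"
proof -
  obtain H where H: "\<And>a b. g a b = H (a + b) * (real (n choose a) * real (n choose b))"
    using cayley_kernel_antidiagonal[OF assms(1,2)] by blast
  have q_le: "a \<le> n" if "coeff q a \<noteq> 0" for a
    using assms(3) that by (meson le_degree order_trans)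
  have diag: "diagonal g c = H c * real (2 * n choose c)" for c
  proof -
    have "diagonal g c = H c * real (\<Sum>a\<le>c. (n choose a) * (n choose (c - a)))"
      by (simp add: diagonal_def H sum_distrib_left)
    then show ?thesis by (simp only: vandermonde mult_2)
  qed
  have "pairing n g (form_square q) = (\<Sum>a\<le>n. \<Sum>b\<le>n. H (a + b) * (coeff q a * coeff q b))"
    by (auto simp: pairing_def H form_square_def intro!: sum.cong)
  also have "\<dots> = (\<Sum>(a, b)\<in>{..n} \<times> {..n}. H (a + b) * (coeff q a * coeff q b))"
    by (simp add: sum.cartesian_product)
  \<comment> \<open>The triangle contains the square, and outside the square a coefficient of q
    vanishes.\<close>
  also have "\<dots> = (\<Sum>(a, b)\<in>{(a, b). a + b \<le> 2 * n}. H (a + b) * (coeff q a * coeff q b))"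
  proof (rule sum.mono_neutral_left)
    show "finite {(a, b). a + b \<le> 2 * n}"
      by (rule finite_subset[of _ "{..2 * n} \<times> {..2 * n}"]) auto
  qed (auto dest: q_le)
  also have "\<dots> = (\<Sum>c\<le>2 * n. \<Sum>a\<le>c. H (a + (c - a)) * (coeff q a * coeff q (c - a)))"
    by (rule sum.triangle_reindex_eq)
  also have "\<dots> = (\<Sum>c\<le>2 * n. H c * coeff (q * q) c)"
    by (simp add: coeff_mult sum_distrib_left)
  also have "\<dots> = (\<Sum>c\<le>2 * n. diagonal g c * coeff (q * q) c / real (2 * n choose c))"
    by (intro sum.cong refl) (simp add: diag)
  finally show ?thesis .
qed

text \<open>Vanishes at the nonzero eigenvalues, those of index 1 to n. It gives the projector onto
  the kernel of T only after division by its value at 0.\<close>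

definition projector_poly :: "nat \<Rightarrow> real poly" where
  "projector_poly n = (\<Prod>j<n. [:casimir_root n (Suc j), -1:])"

text \<open>After passing to degree \<open>n - 1\<close> the factor \<open>j = 1\<close> becomes \<open>- T\<close>, while the others become
  the projector there, whose image \<open>\<Omega>\<close> kills by induction.\<close>
lemma cayley_projector:
  "bidegree_le n g \<Longrightarrow> cayley n (poly_op (projector_poly n) (casimir n) g) = (\<lambda>a b. 0)"
proof (induction n arbitrary: g)
  case 0
  then show ?case by (intro cayley_bidegree_0 bidegree_le_poly_op)
next
  case (Suc n)
  let ?T = "\<lambda>h a b. 2 * real (Suc n) * h a b + casimir n h a b"
  have root: "casimir_root (Suc n) (Suc j) - 2 * real (Suc n) = casimir_root n j" for j
    by (simp add: casimir_root_def algebra_simps)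
  have "pcompose (projector_poly (Suc n)) [:2 * real (Suc n), 1:]
      = (\<Prod>j<Suc n. [:casimir_root n j, -1:])"
    unfolding projector_poly_def pcompose_prod
    by (intro prod.cong refl) (simp add: pcompose_pCons flip: root)
  also have "\<dots> = [:0, -1:] * projector_poly n"
    unfolding projector_poly_def
    by (subst prod.lessThan_Suc_shift) (simp add: casimir_root_def)
  finally have comp: "pcompose (projector_poly (Suc n)) [:2 * real (Suc n), 1:] = [:0, -1:] * projector_poly n" .
  have "cayley (Suc n) (poly_op (projector_poly (Suc n)) (casimir (Suc n)) g)
      = poly_op (projector_poly (Suc n)) ?T (cayley (Suc n) g)"
    by (rule poly_op_intertwine[OF linear_casimir linear_op_shift[OF linear_casimir] linear_cayley])
      (rule cayley_bracket_mult)
  also have "\<dots> = poly_op ([:0, -1:] * projector_poly n) (casimir n) (cayley (Suc n) g)"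
    by (simp only: poly_op_shift[OF linear_casimir] comp)
  also have "\<dots> = (\<lambda>a b. 0)"
    by (simp only: poly_op_linear_factor[OF linear_casimir] Suc.IH[OF bidegree_le_cayley[OF Suc.prems]]
      linear_op_zero[OF linear_bracket_mult]) simp
  finally show ?case .
qed

lemma real_rooted_pairing_square:
  fixes x z :: "'i \<Rightarrow> real" and y w :: "'j \<Rightarrow> real"
  assumes I: "finite I" "card I = n" and J: "finite J" "card J = n"
  defines "p \<equiv> linear_product x z I" and "q \<equiv> linear_product y w J"
  shows "(\<Sum>c\<le>2 * n. coeff (p * p) c * coeff (q * q) c / real (2 * n choose c))
    \<le> (\<Sum>a\<le>n. coeff p a * coeff q a / real (n choose a))\<^sup>2"
proof -
  define E where "E = projector_poly n"
  define K where "K = poly E 0"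
  have "0 < casimir_root n (Suc j)" if "j < n" for j
    using that by (simp add: casimir_root_def)
  then have K: "0 < K" by (auto simp: K_def E_def projector_poly_def poly_prod intro!: prod_pos)
  have E_root: "poly E (casimir_root n (2 * i)) = 0" if "0 < i" "2 * i \<le> n" for i
    using that by (auto simp: E_def projector_poly_def poly_prod intro!: bexI[of _ "2 * i - 1"])
  have root0: "casimir_root n 0 = 0" by (simp add: casimir_root_def)
  \<comment> \<open>One minus the normalised projector: 0 at the root of index 0 and 1 at the other
    even roots, hence nondecreasing there.\<close>
  define \<phi> where "\<phi> = 1 + smult (- 1 / K) E"
  have \<phi>0: "poly \<phi> 0 = 0" using K by (simp add: \<phi>_def flip: K_def)
  have \<phi>1: "poly \<phi> (casimir_root n (2 * i)) = 1" if "0 < i" "2 * i \<le> n" for i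
    using E_root[OF that] by (simp add: \<phi>_def)
  have "0 \<le> pairing n (poly_op \<phi> (casimir n) (form_square p)) (form_square q)"
    unfolding p_def q_def
  proof (rule pairing_poly_casimir_nonneg[OF I J])
    fix i j assume ij: "i \<le> j" "2 * j \<le> n"
    then show "poly \<phi> (casimir_root n (2 * i)) \<le> poly \<phi> (casimir_root n (2 * j))"
      using \<phi>1[of i] \<phi>1[of j] by (cases "i = 0"; cases "j = 0") (simp_all add: \<phi>0 root0)
  qed (simp add: \<phi>0)
  also have "poly_op \<phi> (casimir n) (form_square p)
      = (\<lambda>a b. 1 * form_square p a b + (- 1 / K) * poly_op E (casimir n) (form_square p) a b)"
    unfolding \<phi>_def one_pCons poly_op_add[OF linear_casimir] poly_op_smult[OF linear_casimir]
    by (simp add: poly_op_pCons[OF linear_casimir] linear_op_zero[OF linear_casimir])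
  also have "pairing n \<dots> (form_square q) = pairing n (form_square p) (form_square q)
      - pairing n (poly_op E (casimir n) (form_square p)) (form_square q) / K"
    by (subst pairing_lincomb_left) simp
  also have "pairing n (poly_op E (casimir n) (form_square p)) (form_square q)
      = (\<Sum>c\<le>2 * n. K * coeff (p * p) c * coeff (q * q) c / real (2 * n choose c))"
  proof (subst pairing_cayley_kernel)
    have sup: "bidegree_le n (form_square p)"
      using bidegree_le_form_square[of I x z] by (simp add: p_def I)
    show "bidegree_le n (poly_op E (casimir n) (form_square p))"
      by (rule bidegree_le_poly_op[OF sup])
    show "cayley n (poly_op E (casimir n) (form_square p)) = (\<lambda>a b. 0)"
      unfolding E_def by (rule cayley_projector[OF sup])
    show "degree q \<le> n" using degree_linear_product[of y w J] by (simp add: q_def J)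
  qed (simp add: diagonal_poly_op diagonal_form_square K_def)
  also have "\<dots> / K = (\<Sum>c\<le>2 * n. coeff (p * p) c * coeff (q * q) c / real (2 * n choose c))"
    using K by (simp add: sum_divide_distrib)
  finally show ?thesis by (simp add: pairing_form_square)
qed

section \<open>Permanents of matrices of rank at most two\<close>

lemma coeff_linear_product:
  assumes "finite I"
  shows "coeff (linear_product x z I) a = (\<Sum>S | S \<subseteq> I \<and> card S = a. prod x S * prod z (I - S))"
proof -
  have "linear_product x z I = (\<Prod>i\<in>I. monom (x i) 1 + [:z i:])"
    unfolding linear_product_def by (intro prod.cong refl) (simp add: monom_altdef)
  also have "\<dots> = (\<Sum>S\<in>Pow I. (\<Prod>i\<in>S. monom (x i) 1) * (\<Prod>i\<in>I - S. [:z i:]))"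
    by (rule prod_add[OF assms])
  also have "\<dots> = (\<Sum>S\<in>Pow I. monom (prod x S * prod z (I - S)) (card S))"
  proof (intro sum.cong refl)
    fix S
    have "(\<Prod>i\<in>S. monom (x i) 1) = monom (prod x S) (card S)"
      by (induction S rule: infinite_finite_induct) (simp_all add: mult_monom)
    moreover have "(\<Prod>i\<in>T. [:z i:]) = [:prod z T:]" for T
      by (induction T rule: infinite_finite_induct) (simp_all add: one_pCons)
    ultimately show "(\<Prod>i\<in>S. monom (x i) 1) * (\<Prod>i\<in>I - S. [:z i:]) = monom (prod x S * prod z (I - S)) (card S)"
      by (simp add: smult_monom mult.commute)
  qed
  finally have "coeff (linear_product x z I) a
      = (\<Sum>S\<in>Pow I. if card S = a then prod x S * prod z (I - S) else 0)"
    by (simp add: coeff_sum)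
  also have "\<dots> = (\<Sum>S\<in>{S \<in> Pow I. card S = a}. prod x S * prod z (I - S))"
    using assms by (subst sum.inter_filter[symmetric]) auto
  finally show ?thesis by (simp add: Pow_def)
qed

lemma permutation_between_subsets:
  fixes S T :: "'a::finite set"
  assumes "card S = card T"
  obtains \<sigma> where "\<sigma> permutes UNIV" "\<sigma> ` S = T"
proof -
  obtain f where f: "bij_betw f S T"
    using finite_same_card_bij[of S T] assms by auto
  obtain g where g: "bij_betw g (- S) (- T)"
    using finite_same_card_bij[of "- S" "- T"] assms by (auto simp: Compl_eq_Diff_UNIV card_Diff_subset)
  define \<sigma> where "\<sigma> i = (if i \<in> S then f i else g i)" for i
  have S: "bij_betw \<sigma> S T" using f by (simp add: \<sigma>_def cong: bij_betw_cong)
  have "bij_betw \<sigma> (- S) (- T)" using g by (subst bij_betw_cong[of _ _ g]) (auto simp: \<sigma>_def)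
  from bij_betw_combine[OF S this] have "bij \<sigma>" by (simp add: Compl_partition)
  then have "\<sigma> permutes UNIV" by (intro bij_imp_permutes) auto
  moreover have "\<sigma> ` S = T" using S by (simp add: bij_betw_def)
  ultimately show ?thesis by (rule that)
qed

text \<open>The sum over \<open>\<pi>\<close> depends only on the cardinality of \<open>S\<close>, so it may be averaged over all sets
  of that cardinality; exchanging the sums then makes each permutation contribute the same.\<close>
lemma sum_permutations_image:
  fixes Y :: "'a::finite set \<Rightarrow> real"
  shows "real (CARD('a) choose card S) * (\<Sum>\<pi> | \<pi> permutes UNIV. Y (\<pi> ` S))
    = fact CARD('a) * (\<Sum>U | card U = card S. Y U)"
proof -
  have same: "(\<Sum>\<pi> | \<pi> permutes UNIV. Y (\<pi> ` T)) = (\<Sum>\<pi> | \<pi> permutes UNIV. Y (\<pi> ` S))"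
    if T: "card T = card S" for T
  proof -
    obtain \<sigma> where "\<sigma> permutes UNIV" and \<sigma>: "\<sigma> ` S = T"
      by (rule permutation_between_subsets[OF T[symmetric]])
    have "(\<Sum>\<pi> | \<pi> permutes UNIV. Y (\<pi> ` T)) = (\<Sum>\<pi> | \<pi> permutes UNIV. Y ((\<pi> \<circ> \<sigma>) ` S))"
      unfolding image_comp[symmetric] \<sigma> ..
    also have "\<dots> = (\<Sum>\<pi> | \<pi> permutes UNIV. Y (\<pi> ` S))"
      by (rule sum_permutations_compose_right[symmetric]) fact
    finally show ?thesis .
  qed
  have "real (CARD('a) choose card S) * (\<Sum>\<pi> | \<pi> permutes UNIV. Y (\<pi> ` S))
      = (\<Sum>T | card T = card S. \<Sum>\<pi> | \<pi> permutes UNIV. Y (\<pi> ` T))"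
  proof -
    have "(\<Sum>T | card T = card S. \<Sum>\<pi> | \<pi> permutes UNIV. Y (\<pi> ` T))
        = (\<Sum>T :: 'a set | card T = card S. \<Sum>\<pi> | \<pi> permutes UNIV. Y (\<pi> ` S))"
      by (rule sum.cong[OF refl], rule same) simp
    then show ?thesis using n_subsets[of "UNIV :: 'a set" "card S"] by simp
  qed
  also have "\<dots> = (\<Sum>\<pi> | \<pi> permutes (UNIV :: 'a set). \<Sum>T | card T = card S. Y (\<pi> ` T))"
    by (rule sum.swap)
  also have "\<dots> = (\<Sum>\<pi> | \<pi> permutes (UNIV :: 'a set). \<Sum>U | card U = card S. Y U)"
  proof (rule sum.cong[OF refl])
    fix \<pi> :: "'a \<Rightarrow> 'a" assume "\<pi> \<in> {\<pi>. \<pi> permutes UNIV}"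
    then have \<pi>: "bij \<pi>" by (simp add: permutes_bij)
    have card: "card (f ` T) = card T" if "bij f" for f :: "'a \<Rightarrow> 'a" and T
      by (rule card_image) (use that in \<open>auto simp: bij_def inj_on_def\<close>)
    show "(\<Sum>T | card T = card S. Y (\<pi> ` T)) = (\<Sum>U | card U = card S. Y U)"
      by (rule sum.reindex_bij_witness[of _ "\<lambda>U. inv \<pi> ` U" "\<lambda>T. \<pi> ` T"])
        (use \<pi> in \<open>simp_all add: card bij_imp_bij_inv image_image bij_is_inj bij_is_surj surj_f_inv_f\<close>)
  qed
  also have "\<dots> = fact CARD('a) * (\<Sum>U | card U = card S. Y U)"
    by (simp add: card_permutations[OF refl])
  finally show ?thesis .
qed

text \<open>Expanding each product over the set S of rows that contribute x y leaves a sum over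
  permutations of a function of the image of S, which depends only on the cardinality of S.\<close>

lemma permanent_rank_two:
  fixes x y z w :: "'n::finite \<Rightarrow> real"
  assumes "\<And>i j. A $ i $ j = x i * y j + z i * w j"
  shows "permanent A = fact CARD('n) * (\<Sum>a\<le>CARD('n).
    coeff (linear_product x z UNIV) a * coeff (linear_product y w UNIV) a / real (CARD('n) choose a))"
proof -
  define X where "X S = prod x S * prod z (UNIV - S)" for S
  define Y where "Y S = prod y S * prod w (UNIV - S)" for S
  have "permanent A = (\<Sum>\<pi> | \<pi> permutes (UNIV :: 'n set). \<Sum>S\<in>UNIV. X S * Y (\<pi> ` S))"
    unfolding permanent_def
  proof (intro sum.cong refl)
    fix \<pi> :: "'n \<Rightarrow> 'n" assume "\<pi> \<in> {\<pi>. \<pi> permutes UNIV}"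
    then have \<pi>: "bij \<pi>" by (simp add: permutes_bij)
    have "(\<Prod>i\<in>UNIV. A $ i $ \<pi> i)
      = (\<Sum>S\<in>Pow UNIV. (\<Prod>i\<in>S. x i * y (\<pi> i)) * (\<Prod>i\<in>UNIV - S. z i * w (\<pi> i)))"
      unfolding assms by (rule prod_add) simp
    also have "\<dots> = (\<Sum>S\<in>UNIV. X S * Y (\<pi> ` S))"
    proof (intro sum.cong)
      fix S
      have "inj_on \<pi> S" for S using \<pi> by (auto simp: bij_def inj_on_def)
      moreover have "UNIV - \<pi> ` S = \<pi> ` (UNIV - S)"
        using \<pi> by (simp add: bij_def image_set_diff)
      ultimately show "(\<Prod>i\<in>S. x i * y (\<pi> i)) * (\<Prod>i\<in>UNIV - S. z i * w (\<pi> i)) = X S * Y (\<pi> ` S)"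
        by (simp add: X_def Y_def prod.distrib prod.reindex)
    qed simp
    finally show "(\<Prod>i\<in>UNIV. A $ i $ \<pi> i) = (\<Sum>S\<in>UNIV. X S * Y (\<pi> ` S))" .
  qed
  also have "\<dots> = (\<Sum>S\<in>UNIV. X S * (\<Sum>\<pi> | \<pi> permutes (UNIV :: 'n set). Y (\<pi> ` S)))"
    by (subst sum.swap) (simp add: sum_distrib_left)
  also have "\<dots> = (\<Sum>a\<le>CARD('n). \<Sum>S | card S = a. X S * (\<Sum>\<pi> | \<pi> permutes (UNIV :: 'n set). Y (\<pi> ` S)))"
  proof -
    have "(\<Sum>a\<le>CARD('n). \<Sum>S\<in>{S \<in> UNIV. card S = a}. X S * (\<Sum>\<pi> | \<pi> permutes (UNIV :: 'n set). Y (\<pi> ` S)))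
      = (\<Sum>S\<in>UNIV. X S * (\<Sum>\<pi> | \<pi> permutes (UNIV :: 'n set). Y (\<pi> ` S)))"
      by (rule sum.group) (auto intro: card_mono)
    then show ?thesis by simp
  qed
  also have "\<dots> = (\<Sum>a\<le>CARD('n). fact CARD('n) * ((\<Sum>S | card S = a. X S) * (\<Sum>S | card S = a. Y S)
      / real (CARD('n) choose a)))"
  proof (intro sum.cong refl)
    fix a assume a: "a \<in> {..CARD('n)}"
    have "X S * (\<Sum>\<pi> | \<pi> permutes (UNIV :: 'n set). Y (\<pi> ` S))
        = fact CARD('n) * (X S * (\<Sum>S | card S = a. Y S) / real (CARD('n) choose a))" if "card S = a" for S
      using sum_permutations_image[of S Y] that a by (simp add: field_simps)
    then show "(\<Sum>S | card S = a. X S * (\<Sum>\<pi> | \<pi> permutes (UNIV :: 'n set). Y (\<pi> ` S)))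
      = fact CARD('n) * ((\<Sum>S | card S = a. X S) * (\<Sum>S | card S = a. Y S) / real (CARD('n) choose a))"
      by (simp add: sum_distrib_left[symmetric] sum_distrib_right[symmetric] sum_divide_distrib[symmetric])
  qed
  finally show ?thesis
    by (simp add: coeff_linear_product X_def Y_def sum_distrib_left)
qed

lemma rank_le_two_decomposition:
  fixes A :: "real ^ 'n ^ 'm"
  assumes "rank A \<le> 2"
  obtains x z y w where "\<And>i j. A $ i $ j = x i * y j + z i * w j"
proof -
  obtain B where B: "B \<subseteq> rows A" "independent B" "rows A \<subseteq> span B" "card B = dim (rows A)"
    by (rule basis_exists)
  have "finite B" using B(2) by (rule independent_imp_finite)
  moreover have "card B \<le> 2" using assms B(4) by (simp add: row_rank_def)
  ultimately have "B = {} \<or> card B = 1 \<or> card B = 2"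
    by (metis One_nat_def card_0_eq le_neq_implies_less less_2_cases)
  then have "\<exists>u v. B \<subseteq> {u, v}"
    by (auto simp: card_1_singleton_iff card_2_iff)
  then obtain u v where "B \<subseteq> {u, v}" by blast
  then have span: "row i A \<in> span {u, v}" for i
    using B(3) span_mono[of B "{u, v}"] by (auto simp: rows_def)
  have "\<exists>c d. row i A = c *\<^sub>R u + d *\<^sub>R v" for i
  proof -
    obtain c where "row i A - c *\<^sub>R u \<in> span {v}"
      using span[of i] span_breakdown_eq[of "row i A" u "{v}"] by auto
    then obtain d where "row i A - c *\<^sub>R u = d *\<^sub>R v"
      by (auto simp: span_singleton)
    then have "row i A = c *\<^sub>R u + d *\<^sub>R v" by (simp add: algebra_simps)
    then show ?thesis by blast
  qed
  then obtain c d where cd: "\<And>i. row i A = c i *\<^sub>R u + d i *\<^sub>R v" by metis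
  have "A $ i $ j = c i * u $ j + d i * v $ j" for i j
    using arg_cong[OF cd[of i], of "\<lambda>r. r $ j"] by (simp add: row_def)
  then show ?thesis by (rule that)
qed

theorem theorem1p2:
  fixes A :: "real ^ 'n ^ 'n"
  assumes "rank A \<le> 2"
  shows "(permanent A)\<^sup>2 \<ge>
    1 / real ((2 * CARD('n)) choose CARD('n)) * permanent (kronecker_product A J2)"
proof -
  let ?n = "CARD('n)"
  have card_2: "CARD(2) = 2" by simp
  obtain x z y w where A: "\<And>i j. A $ i $ j = x i * y j + z i * w j"
    using rank_le_two_decomposition[OF assms] by metis
  define p where "p = linear_product x z (UNIV :: 'n set)"
  define q where "q = linear_product y w (UNIV :: 'n set)"
  define s where "s = (\<Sum>a\<le>?n. coeff p a * coeff q a / real (?n choose a))"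
  define t where "t = (\<Sum>c\<le>2 * ?n. coeff (p * p) c * coeff (q * q) c / real (2 * ?n choose c))"
  \<comment> \<open>Each row and column of \<open>A\<close> occurs twice in the Kronecker product,
    so p and q are replaced by their squares.\<close>
  have double: "linear_product (\<lambda>k. f (fst k)) (\<lambda>k. g (fst k)) (UNIV :: ('n \<times> 2) set)
      = linear_product f g UNIV * linear_product f g UNIV" for f g
  proof -
    have "linear_product (\<lambda>k. f (fst k)) (\<lambda>k. g (fst k)) (UNIV :: ('n \<times> 2) set)
        = (\<Prod>i\<in>(UNIV :: 'n set). \<Prod>k\<in>(UNIV :: 2 set). [:g i, f i:])"
      unfolding linear_product_def UNIV_Times_UNIV[symmetric] prod.cartesian_product
      by (simp add: case_prod_beta)
    then show ?thesis
      by (simp only: linear_product_def prod_constant card_2 power2_eq_square prod.distrib)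
  qed
  have "kronecker_product A J2 $ r $ c = x (fst r) * y (fst c) + z (fst r) * w (fst c)" for r c
    by (simp add: kronecker_product_def J2_def A)
  then have "permanent (kronecker_product A J2) = fact (2 * ?n) * t"
    using permanent_rank_two[of "kronecker_product A J2" "\<lambda>k. x (fst k)" "\<lambda>k. y (fst k)" "\<lambda>k. z (fst k)" "\<lambda>k. w (fst k)"]
    by (simp only: double t_def p_def q_def card_prod card_2 mult.commute[of ?n 2])
  moreover have "real (2 * ?n choose ?n) = fact (2 * ?n) / (fact ?n * fact ?n)"
    by (subst binomial_fact) simp_all
  ultimately have "1 / real (2 * ?n choose ?n) * permanent (kronecker_product A J2) = (fact ?n)\<^sup>2 * t"
    by (simp add: power2_eq_square)
  also have "\<dots> \<le> (fact ?n)\<^sup>2 * s\<^sup>2"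
    using real_rooted_pairing_square[of "UNIV :: 'n set" ?n "UNIV :: 'n set" x z y w]
    unfolding s_def t_def p_def q_def by (intro mult_left_mono) simp_all
  also have "\<dots> = (permanent A)\<^sup>2"
    unfolding permanent_rank_two[OF A] s_def p_def q_def by (rule power_mult_distrib[symmetric])
  finally show ?thesis .
qed

end
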